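(* Let $m\ge n\ge 1$ and let $\alpha_1,\dots,\alpha_n\in\mathbb{R}^m$ be linearly independent. Let $P=\{\sum_{i=1}^n x_i\alpha_i : 0\le x_i\le 1,\ i=1,\dots,n\}$ be the parallel polyhedron generated by $\alpha_1,\dots,\alpha_n$. Then the generalized volume of $P$ satisfies $$GV(P)=|\mathrm{Gdet}(\alpha_1,\dots,\alpha_n)|,$$ where $(\alpha_1,\dots,\alpha_n)$ denotes the $m\times n$ matrix with columns $\alpha_1,\dots,\alpha_n$.
   Context: Generalized volume: put $A=(\alpha_1,\dots,\alpha_n)\in\mathbb{R}^{m\times n}$ and let $A=QR$ be its $QR$ decomposition, i.e. $Q\in\mathbb{R}^{m\times n}$ with $Q^TQ=I_n$ and $R\in\mathbb{R}^{n\times n}$ upper triangular with positive diagonal entries. Let $q_i$ be the $i$-th column of $Q$, and let $\phi:\mathrm{span}\{\alpha_1,\dots,\alpha_n\}\to\mathbb{R}^n$ be the linear map with $\phi(q_i)=e_i$ (the $i$-th standard basis vector of $\mathbb{R}^n$). Then $GV(P):=V(\phi(P))$, where $V$ denotes the usual $n$-dimensional volume in $\mathbb{R}^n$. Generalized determinant: all matrices are real. Let $m\ge n\ge 1$. $S_m$ is the symmetric group on $\{1,\dots,m\}$ with identity element $(1)$. For $\sigma\in S_m$ let $\Phi(\sigma)$ be the $m\times m$ permutation matrix whose $i$-th row is $e_{\sigma(i)}^T$ ($e_j$ = $j$-th column of $I_m$), let $I_{m\times n}=(e_1,\dots,e_n)$, and $P_\sigma=\Phi(\sigma)I_{m\times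 n}\in\mathbb{R}^{m\times n}$. For $A\in\mathbb{R}^{m\times n}$ put $A^\sigma=P_\sigma^TA\in\mathbb{R}^{n\times n}$ (so the $j$-th row of $A^\sigma$ is the $\sigma^{-1}(j)$-th row of $A$). Totally order $S_m$ by: $\sigma>\tau$ iff there is $t$ with $\sigma(t)>\tau(t)$ and $\sigma(j)=\tau(j)$ for all $j>t$. Let $\sigma_A=(1)$ if $A$ is not of full column rank, and otherwise $\sigma_A=\max\{\sigma\in S_m:\det(A^\sigma)\neq 0\}$. The principal submatrix of $A$ is $A_P=A^{\sigma_A}$, and $\mathrm{sign}(A)\in\{1,0,-1\}$ is the sign of the real number $\det(A_P)$. Then for $m\ge n$ $$\mathrm{Gdet}(A)=\mathrm{sign}(A)\Big(\sum_{1\le i_1<\dots<i_n\le m}\det(A_{i_1,\dots,i_n})^2\Big)^{1/2},$$ where $A_{i_1,\dots,i_n}$ is the $n\times n$ submatrix formed by rows $i_1,\dots,i_n$ of $A$. *)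

theory Defs
  imports "HOL-Analysis.Analysis"
begin

text \<open>
  An $m \times n$ matrix is a \<^typ>\<open>real^'n^'m\<close> (first index: row), where the index types are
  finite and well-ordered and stand for $\{1 < \dots < n\}$ and $\{1 < \dots < m\}$. The number
  attached to an index is, counted from 0, its position in the order.
\<close>

definition pos :: "'k::{finite,wellorder} \<Rightarrow> nat" where
  "pos i = card {j. j < i}"

definition cols_matrix :: "('n \<Rightarrow> real^'m) \<Rightarrow> real^'n^'m" where
  "cols_matrix \<alpha> = (\<chi> i j. \<alpha> j $ i)"

definition parallel_polyhedron :: "('n::finite \<Rightarrow> real^'m) \<Rightarrow> (real^'m) set" where
  "parallel_polyhedron \<alpha> = {(\<Sum>i\<in>UNIV. x i *\<^sub>R \<alpha> i) | x. \<forall>i. 0 \<le> x i \<and> x i \<le> 1}"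


subsection \<open>Generalized volume\<close>

definition is_QR ::
    "real^'n::{finite,wellorder}^'m::finite \<Rightarrow> real^'n::_^'m::_ \<Rightarrow> real^'n::_^'n::_ \<Rightarrow> bool" where
  "is_QR A Q R \<longleftrightarrow>
     A = Q ** R \<and> transpose Q ** Q = mat 1 \<and>
     (\<forall>i j. j < i \<longrightarrow> R $ i $ j = 0) \<and> (\<forall>i. 0 < R $ i $ i)"

definition QR_Q :: "real^'n::{finite,wellorder}^'m::finite \<Rightarrow> real^'n::_^'m::_" where
  "QR_Q A = fst (THE (Q, R). is_QR A Q R)"

text \<open>
  The linear map sending the columns of \<open>Q\<close> to the standard basis. It is uniquely determined on the
  span of these columns; being a total function, it is a linear extension of that map to the whole
  space, and its values outside the span carry no meaning.
\<close>

definition frame_map :: "real^'n::finite^'m::finite \<Rightarrow> real^'m \<Rightarrow> real^'n" where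
  "frame_map Q = (SOME \<phi>. linear \<phi> \<and> (\<forall>i. \<phi> (column i Q) = axis i 1))"

text \<open>Meaningful for sets \<open>P\<close> contained in the column span of \<open>A\<close>.\<close>

definition GV :: "real^'n::{finite,wellorder}^'m::finite \<Rightarrow> (real^'m::_) set \<Rightarrow> real" where
  "GV A P = measure lebesgue (frame_map (QR_Q A) ` P)"


subsection \<open>Generalized determinant\<close>

definition perm_matrix :: "('m \<Rightarrow> 'm) \<Rightarrow> real^'m::finite^'m" where
  "perm_matrix \<sigma> = (\<chi> i. axis (\<sigma> i) 1)"

definition I_mn :: "real^'n::{finite,wellorder}^'m::{finite,wellorder}" where
  "I_mn = (\<chi> i j. if pos i = pos j then 1 else 0)"

definition P_mat :: "('m \<Rightarrow> 'm) \<Rightarrow> real^'n::{finite,wellorder}^'m::{finite,wellorder}" where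
  "P_mat \<sigma> = perm_matrix \<sigma> ** I_mn"

definition perm_submatrix ::
    "real^'n::{finite,wellorder}^'m::{finite,wellorder} \<Rightarrow> ('m \<Rightarrow> 'm) \<Rightarrow> real^'n::_^'n::_" where
  "perm_submatrix A \<sigma> = transpose (P_mat \<sigma>) ** A"

definition perm_greater :: "('m::{finite,wellorder} \<Rightarrow> 'm) \<Rightarrow> ('m \<Rightarrow> 'm) \<Rightarrow> bool" where
  "perm_greater \<sigma> \<tau> \<longleftrightarrow> (\<exists>t. \<sigma> t > \<tau> t \<and> (\<forall>j>t. \<sigma> j = \<tau> j))"

definition sigma_of :: "real^'n::{finite,wellorder}^'m::{finite,wellorder} \<Rightarrow> 'm \<Rightarrow> 'm" where
  "sigma_of A =
     (if rank A \<noteq> CARD('n) then id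
      else THE \<sigma>. \<sigma> permutes UNIV \<and> det (perm_submatrix A \<sigma>) \<noteq> 0 \<and>
             (\<forall>\<tau>. \<tau> permutes UNIV \<and> det (perm_submatrix A \<tau>) \<noteq> 0 \<longrightarrow> \<tau> = \<sigma> \<or> perm_greater \<sigma> \<tau>))"

definition principal_submatrix ::
    "real^'n::{finite,wellorder}^'m::{finite,wellorder} \<Rightarrow> real^'n::_^'n::_" where
  "principal_submatrix A = perm_submatrix A (sigma_of A)"

definition mat_sign :: "real^'n::{finite,wellorder}^'m::{finite,wellorder} \<Rightarrow> real" where
  "mat_sign A = sgn (det (principal_submatrix A))"

text \<open>
  The index tuples $i_1 < \dots < i_n$ are the strictly increasing functions from \<open>'n\<close> to \<open>'m\<close>. The
  definition is meant for $m \ge n$.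
\<close>

definition Gdet :: "real^'n::{finite,wellorder}^'m::{finite,wellorder} \<Rightarrow> real" where
  "Gdet A = mat_sign A *
     sqrt (\<Sum>r | strict_mono (r :: 'n \<Rightarrow> 'm). (det (\<chi> k. A $ r k :: real^'n::_^'n::_))\<^sup>2)"

end

theory Submission imports Defs begin

text \<open>
  If \<open>A = Q R\<close> is the QR decomposition, the map sending the columns of \<open>Q\<close> to the standard basis
  sends those of \<open>A\<close> to those of \<open>R\<close>, so it carries the parallel polyhedron to the image of the unit
  cube under \<open>R\<close>, of volume \<open>\<bar>det R\<bar>\<close>. On the other hand \<open>(det R)\<^sup>2 = det (A\<^sup>T A)\<close> is by the
  Cauchy--Binet formula the sum of the squared maximal minors of \<open>A\<close>. As this sum is nonzero, some
  minor does not vanish, so the permutation defining the principal submatrix exists and \<open>A\<close> has sign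
  \<open>\<plusminus>1\<close>.
\<close>

section \<open>Positions in finite orders and factorisation of injective index tuples\<close>

lemma pos_less_iff: "pos i < pos j \<longleftrightarrow> i < (j::'k::{finite,wellorder})"
proof -
  have "pos i < pos j" if "i < j" for i j :: 'k
    unfolding pos_def using that by (intro psubset_card_mono) auto
  then show ?thesis
    by (metis linorder_neqE order_less_asym)
qed

lemma pos_eq_iff: "pos i = pos j \<longleftrightarrow> i = (j::'k::{finite,wellorder})"
  by (metis linorder_neqE order_less_irrefl pos_less_iff)

text \<open>Equality holds by counting: positions are distinct and below \<open>CARD('k)\<close>,
  and there are \<open>CARD('k)\<close> of them.\<close>

lemma range_pos: "range (pos :: 'k::{finite,wellorder} \<Rightarrow> nat) = {..<CARD('k)}"
proof (rule card_subset_eq)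
  show "range (pos :: 'k \<Rightarrow> nat) \<subseteq> {..<CARD('k)}"
    unfolding pos_def by (auto intro!: psubset_card_mono)
  show "card (range (pos :: 'k \<Rightarrow> nat)) = card {..<CARD('k)}"
    by (simp add: card_image inj_def pos_eq_iff)
qed simp

lemma ex_pos:
  assumes "k < CARD('k::{finite,wellorder})"
  shows "\<exists>i::'k. pos i = k"
  using assms range_pos[where 'k='k] by (metis imageE lessThan_iff)

text \<open>
  The permutation sends \<open>i\<close> to the index whose position is the number of values of \<open>f\<close> below \<open>f i\<close>.
\<close>

lemma inj_factor_strict_mono:
  fixes f :: "'n::{finite,wellorder} \<Rightarrow> 'm::linorder"
  assumes "inj f"
  obtains r p where "strict_mono r" "p permutes UNIV" "f = r \<circ> p"
proof -
  let ?c = "\<lambda>i. card {j. f j < f i}"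
  \<comment> \<open>The count misses \<open>i\<close> itself, so it stays below
    \<open>CARD('n)\<close> and is the position of some index.\<close>
  have "\<exists>q. pos (q :: 'n) = ?c i" for i
    by (rule ex_pos) (auto intro!: psubset_card_mono)
  then obtain p :: "'n \<Rightarrow> 'n" where p: "\<And>i. pos (p i) = ?c i"
    by metis
  have less: "p i < p j \<longleftrightarrow> f i < f j" for i j
  proof -
    have "?c i < ?c j" if "f i < f j" for i j
      using that by (intro psubset_card_mono) auto
    then show ?thesis
      by (metis linorder_neqE order_less_asym p pos_less_iff)
  qed
  have "inj p"
    using assms less by (metis injD injI linorder_neqE order_less_irrefl)
  then have bij: "bij p"
    by (simp add: bij_def finite_UNIV_inj_surj)
  show thesis
  proof
    \<comment> \<open>By \<open>less\<close>, \<open>p\<close> orders the indices exactly as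
      \<open>f\<close> orders its values, so undoing \<open>p\<close> leaves an increasing
      map.\<close>
    show "strict_mono (f \<circ> inv p)"
      using bij by (auto intro!: strict_monoI simp flip: less simp: bij_is_surj surj_f_inv_f)
    show "p permutes UNIV"
      using bij by (intro bij_imp_permutes) auto
    show "f = (f \<circ> inv p) \<circ> p"
      using \<open>inj p\<close> by (simp add: fun_eq_iff)
  qed
qed

text \<open>Since \<open>r\<close> preserves comparisons, the position of \<open>p i\<close> is the
  number of values of the composite below its value at \<open>i\<close>. The composite thus
  determines \<open>p\<close>, and cancelling \<open>p\<close> determines \<open>r\<close>.\<close>

lemma strict_mono_factor_unique:
  fixes r s :: "'n::{finite,wellorder} \<Rightarrow> 'm::linorder"
  assumes "strict_mono r" "strict_mono s" "p permutes UNIV" "q permutes UNIV" "r \<circ> p = s \<circ> q"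
  shows "r = s \<and> p = q"
proof -
  have count: "pos (p i) = card {j. (r \<circ> p) j < (r \<circ> p) i}"
    if "strict_mono r" "p permutes UNIV" for r :: "'n \<Rightarrow> 'm" and p i
  proof -
    have "{j. (r \<circ> p) j < (r \<circ> p) i} = p -` {j. j < p i}"
      using that by (auto simp: strict_mono_less)
    moreover have "card (p -` {j. j < p i}) = card {j. j < p i}"
      using that(2) by (intro card_vimage_inj) (auto simp: permutes_inj permutes_surj)
    ultimately show ?thesis
      by (simp add: pos_def)
  qed
  have "p = q"
    by (rule ext, rule iffD1[OF pos_eq_iff])
       (simp only: count[OF assms(1,3)] count[OF assms(2,4)] assms(5))
  moreover have "r = s"
    using assms(3,5) \<open>p = q\<close> by (metis comp_id fun.map_comp permutes_inv_o(1))
  ultimately show ?thesis by simp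
qed

text \<open>A choice of distinct rows amounts to an increasing tuple and a reordering of it; the
  Cauchy--Binet sum is regrouped along this bijection.\<close>

lemma bij_betw_strict_mono_permutes:
  "bij_betw (\<lambda>(r, p). r \<circ> p)
     ({r. strict_mono r} \<times> {p. p permutes UNIV}) {f :: 'n::{finite,wellorder} \<Rightarrow> 'm::linorder. inj f}"
  unfolding bij_betw_def
proof
  show "inj_on (\<lambda>(r, p). r \<circ> p) ({r :: 'n \<Rightarrow> 'm. strict_mono r} \<times> {p. p permutes UNIV})"
  proof (rule inj_onI, clarify)
    fix r s :: "'n \<Rightarrow> 'm" and p q :: "'n \<Rightarrow> 'n"
    assume "strict_mono r" "strict_mono s" "p permutes UNIV" "q permutes UNIV" "r \<circ> p = s \<circ> q"
    then show "r = s \<and> p = q"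
      by (rule strict_mono_factor_unique)
  qed
  show "(\<lambda>(r, p). r \<circ> p) ` ({r :: 'n \<Rightarrow> 'm. strict_mono r} \<times> {p. p permutes UNIV}) = {f. inj f}"
  proof (intro subset_antisym subsetI)
    fix f :: "'n \<Rightarrow> 'm"
    assume "f \<in> (\<lambda>(r, p). r \<circ> p) ` ({r. strict_mono r} \<times> {p. p permutes UNIV})"
    then show "f \<in> {f. inj f}"
      by (auto simp: strict_mono_imp_inj_on permutes_inj inj_compose)
  next
    fix f :: "'n \<Rightarrow> 'm" assume "f \<in> {f. inj f}"
    then obtain r p where "strict_mono r" "p permutes UNIV" "f = r \<circ> p"
      using inj_factor_strict_mono by blast
    then show "f \<in> (\<lambda>(r, p). r \<circ> p) ` ({r. strict_mono r} \<times> {p. p permutes UNIV})"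
      by (auto intro: image_eqI[of _ _ "(r, p)"])
  qed
qed

section \<open>The Cauchy--Binet formula\<close>

text \<open>In the Leibniz formula, each product of row sums expands into a sum over all choice
  functions \<open>f\<close>.\<close>

lemma det_rows_sum:
  fixes a :: "'n::finite \<Rightarrow> 'm::finite \<Rightarrow> 'a::comm_ring_1^'n"
  shows "det (\<chi> i. \<Sum>k\<in>UNIV. a i k) = (\<Sum>f\<in>UNIV. det (\<chi> i. a i (f i)))"
proof -
  have "(\<Prod>i\<in>UNIV. \<Sum>k\<in>UNIV. a i k $ p i) = (\<Sum>f\<in>UNIV. \<Prod>i\<in>UNIV. a i (f i) $ p i)"
    for p :: "'n \<Rightarrow> 'n"
    by (subst prod_sum_PiE) (auto simp: PiE_UNIV_domain)
  then show ?thesis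
    unfolding det_def by (subst sum.swap) (simp add: sum_distrib_left)
qed

text \<open>Each row of the product is a combination of the rows of \<open>B\<close>, so
  multilinearity gives a sum over all row choices \<open>f\<close>. Choices repeating a row vanish;
  the others are grouped by their increasing rearrangement \<open>r\<close>.\<close>

lemma Cauchy_Binet:
  fixes A B :: "'a::comm_ring_1^'n::{finite,wellorder}^'m::{finite,linorder}"
  shows "det (transpose A ** B) =
    (\<Sum>r | strict_mono (r :: 'n \<Rightarrow> 'm).
       det (\<chi> k. A $ r k :: 'a^'n::_^'n::_) * det (\<chi> k. B $ r k :: 'a^'n::_^'n::_))"
proof -
  let ?D = "\<lambda>C r. det (\<chi> k. C $ r k :: 'a^'n::_^'n::_)"
  let ?t = "\<lambda>f :: 'n \<Rightarrow> 'm. (\<Prod>i\<in>UNIV. A $ f i $ i) * ?D B f"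
  have rows: "transpose A ** B = (\<chi> i. \<Sum>k\<in>UNIV. A $ k $ i *s B $ k)"
    by (vector matrix_matrix_mult_def transpose_def sum_component)
  have "det (transpose A ** B) = (\<Sum>f\<in>UNIV. ?t f)"
    unfolding rows by (subst det_rows_sum) (simp_all add: det_rows_mul)
  also have "\<dots> = (\<Sum>f | inj f. ?t f)"
  proof (rule sum.mono_neutral_right)
    show "\<forall>f \<in> UNIV - {f. inj f}. ?t f = 0"
    proof
      fix f :: "'n \<Rightarrow> 'm" assume "f \<in> UNIV - {f. inj f}"
      then obtain i j where "i \<noteq> j" "f i = f j" by (auto simp: inj_def)
      then have "?D B f = 0"
        by (intro det_identical_rows[of i j]) (auto simp: row_def)
      then show "?t f = 0" by simp
    qed
  qed auto
  also have "\<dots> = (\<Sum>(r, p) \<in> {r. strict_mono r} \<times> {p. p permutes UNIV}. ?t (r \<circ> p))"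
    by (subst sum.reindex_bij_betw[OF bij_betw_strict_mono_permutes, symmetric])
       (simp add: case_prod_unfold)
  also have "\<dots> = (\<Sum>r | strict_mono r. \<Sum>p | p permutes UNIV. ?t (r \<circ> p))"
    by (simp add: sum.cartesian_product)
  also have "\<dots> = (\<Sum>r | strict_mono r. ?D A r * ?D B r)"
  proof (rule sum.cong[OF refl])
    fix r :: "'n \<Rightarrow> 'm"
    have "?t (r \<circ> p) = of_int (sign p) * (\<Prod>i\<in>UNIV. A $ r (p i) $ i) * ?D B r"
      if "p permutes UNIV" for p
      using det_permute_rows[OF that, of "\<chi> k. B $ r k :: 'a^'n::_^'n::_"]
      by (simp add: mult_ac)
    \<comment> \<open>Transposing lets \<open>p\<close> act on rows in the Leibniz formula; the
      signs it needs come from reordering the rows of \<open>B\<close>.\<close>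
    moreover have "?D A r = (\<Sum>p | p permutes UNIV. of_int (sign p) * (\<Prod>i\<in>UNIV. A $ r (p i) $ i))"
      by (subst det_transpose[symmetric]) (simp add: det_def transpose_def)
    ultimately show "(\<Sum>p | p permutes UNIV. ?t (r \<circ> p)) = ?D A r * ?D B r"
      by (simp add: sum_distrib_right)
  qed
  finally show ?thesis .
qed

section \<open>The principal submatrix and the order on permutations\<close>

text \<open>Column \<open>j\<close> of \<open>P_mat \<sigma>\<close> has its only 1 in row
  \<open>i\<close>. Positions mediate between the two index types.\<close>

lemma perm_submatrix_row:
  fixes A :: "real^'n::{finite,wellorder}^'m::{finite,wellorder}"
  assumes "\<sigma> permutes UNIV" "pos (\<sigma> i) = pos j"
  shows "perm_submatrix A \<sigma> $ j = A $ i"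
proof -
  have P: "(P_mat \<sigma> :: real^'n::_^'m::_) $ l $ j = (if l = i then 1 else 0)" for l
  proof -
    have "(P_mat \<sigma> :: real^'n::_^'m::_) $ l $ j = (if pos (\<sigma> l) = pos j then 1 else 0)"
    proof -
      have "(P_mat \<sigma> :: real^'n::_^'m::_) $ l $ j = I_mn $ \<sigma> l $ j"
        by (simp add: P_mat_def matrix_matrix_mult_def perm_matrix_def axis_def mult_delta_left)
      then show ?thesis
        by (simp add: I_mn_def)
    qed
    also have "pos (\<sigma> l) = pos j \<longleftrightarrow> l = i"
      using assms by (metis injD permutes_inj pos_eq_iff)
    finally show ?thesis .
  qed
  have "perm_submatrix A \<sigma> $ j $ k = A $ i $ k" for k
    by (simp add: perm_submatrix_def matrix_matrix_mult_def transpose_def P mult_delta_left)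
  then show ?thesis
    by (simp add: vec_eq_iff)
qed

text \<open>The two ranges are equally large, hence so are their complements; any bijection between
  the complements is glued to \<open>g \<circ> inv f\<close>.\<close>

lemma inj_extend_permutes:
  fixes f g :: "'a \<Rightarrow> 'b::finite"
  assumes "inj f" "inj g"
  obtains \<sigma> where "\<sigma> permutes UNIV" "\<And>x. \<sigma> (f x) = g x"
proof -
  have 1: "bij_betw (g \<circ> inv f) (range f) (range g)"
    using assms by (auto intro!: bij_betw_trans[of _ _ UNIV] inj_imp_bij_betw_inv inj_on_imp_bij_betw)
  then have "card (- range f) = card (- range g)"
    by (simp add: Compl_eq_Diff_UNIV card_Diff_subset bij_betw_same_card)
  then obtain h where 2: "bij_betw h (- range f) (- range g)"
    using finite_same_card_bij[of "- range f" "- range g"] by auto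
  let ?\<sigma> = "\<lambda>x. if x \<in> range f then (g \<circ> inv f) x else h x"
  have "bij ?\<sigma>"
    using bij_betw_disjoint_Un[OF 1 2] by simp
  then show thesis
    using \<open>inj f\<close> by (intro that[of ?\<sigma>] bij_imp_permutes) auto
qed

text \<open>Hence a nonzero maximal minor shows that the set of permutations maximised over in
  \<open>sigma_of\<close> is nonempty.\<close>

lemma ex_perm_submatrix_eq:
  fixes A :: "real^'n::{finite,wellorder}^'m::{finite,wellorder}"
  assumes "CARD('n) \<le> CARD('m)" "inj (r :: 'n \<Rightarrow> 'm)"
  shows "\<exists>\<sigma>. \<sigma> permutes UNIV \<and> perm_submatrix A \<sigma> = (\<chi> k. A $ r k)"
proof -
  have "pos (j :: 'n) < CARD('m)" for j
    using range_pos[where 'k='n] assms(1) by (metis less_le_trans lessThan_iff rangeI)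
  \<comment> \<open>\<open>\<iota>\<close> embeds the column indices as the initial segment of the
    row indices; \<open>\<sigma>\<close> has to move each selected row \<open>r j\<close> to
    \<open>\<iota> j\<close>.\<close>
  then have "\<exists>\<iota> :: 'n \<Rightarrow> 'm. \<forall>j. pos (\<iota> j) = pos j"
    by (intro choice allI ex_pos)
  then obtain \<iota> :: "'n \<Rightarrow> 'm" where \<iota>: "\<And>j. pos (\<iota> j) = pos j"
    by blast
  then have "inj \<iota>"
    by (metis injI pos_eq_iff)
  then obtain \<sigma> where \<sigma>: "\<sigma> permutes UNIV" "\<And>j. \<sigma> (r j) = \<iota> j"
    using inj_extend_permutes[OF assms(2)] by metis
  then have "perm_submatrix A \<sigma> $ j = A $ r j" for j
    by (intro perm_submatrix_row) (simp_all add: \<iota>)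
  then show ?thesis
    using \<sigma>(1) by (auto simp: vec_eq_iff)
qed

lemma perm_greater_total:
  fixes \<sigma> \<tau> :: "'m::{finite,wellorder} \<Rightarrow> 'm"
  assumes "\<sigma> \<noteq> \<tau>"
  shows "perm_greater \<sigma> \<tau> \<or> perm_greater \<tau> \<sigma>"
proof -
  let ?D = "{j. \<sigma> j \<noteq> \<tau> j}"
  \<comment> \<open>The largest index of disagreement decides the comparison.\<close>
  have "Max ?D \<in> ?D"
    using assms by (intro Max_in) (auto simp: fun_eq_iff)
  moreover have "\<forall>j > Max ?D. \<sigma> j = \<tau> j"
    using Max_ge[of ?D] by (metis (mono_tags) finite mem_Collect_eq not_le)
  ultimately show ?thesis
    unfolding perm_greater_def by (metis (mono_tags) linorder_neqE mem_Collect_eq)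
qed

lemma perm_greater_asym: "perm_greater \<sigma> \<tau> \<Longrightarrow> \<not> perm_greater \<tau> \<sigma>"
  unfolding perm_greater_def by (metis linorder_neqE order_less_asym order_less_irrefl)

lemma perm_greater_trans:
  assumes "perm_greater \<sigma> \<tau>" "perm_greater \<tau> \<rho>"
  shows "perm_greater \<sigma> \<rho>"
proof -
  obtain s t where "\<sigma> s > \<tau> s" "\<forall>j>s. \<sigma> j = \<tau> j" "\<tau> t > \<rho> t" "\<forall>j>t. \<tau> j = \<rho> j"
    using assms unfolding perm_greater_def by blast
  then show ?thesis
    unfolding perm_greater_def
    \<comment> \<open>Above both deciding indices all three permutations agree, so the larger of the
      two decides.\<close>
    by (intro exI[of _ "max s t"]) (cases s t rule: linorder_cases; auto simp: max_def)
qed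

text \<open>The description in \<open>sigma_of\<close> is meaningful once a greatest admissible
  permutation exists and is unique; this follows from finiteness and the linear order.\<close>

lemma det_principal_submatrix_nonzero:
  fixes A :: "real^'n::{finite,wellorder}^'m::{finite,wellorder}"
  assumes "rank A = CARD('n)"
    and "\<exists>\<sigma>. \<sigma> permutes UNIV \<and> det (perm_submatrix A \<sigma>) \<noteq> 0"
  shows "det (principal_submatrix A) \<noteq> 0"
proof -
  let ?S = "{\<sigma>. \<sigma> permutes UNIV \<and> det (perm_submatrix A \<sigma>) \<noteq> 0}"
  let ?Q = "\<lambda>\<sigma>. \<sigma> permutes UNIV \<and> det (perm_submatrix A \<sigma>) \<noteq> 0 \<and>
    (\<forall>\<tau>. \<tau> permutes UNIV \<and> det (perm_submatrix A \<tau>) \<noteq> 0 \<longrightarrow> \<tau> = \<sigma> \<or> perm_greater \<sigma> \<tau>)"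
  \<comment> \<open>Reading \<open>perm_greater\<close> as the strict order, a minimal element is a
    maximal permutation; totality then makes it the greatest.\<close>
  have "\<exists>m\<in>?S. \<forall>x\<in>?S. x \<noteq> m \<longrightarrow> \<not> perm_greater x m"
    using assms(2) perm_greater_asym perm_greater_trans
    by (intro Finite_Set.bex_min_element) (auto simp: asymp_on_def transp_on_def, blast)
  then obtain \<sigma> where \<sigma>: "?Q \<sigma>"
    using perm_greater_total by blast
  have "\<exists>!\<sigma>. ?Q \<sigma>"
  proof (rule ex1I[of _ \<sigma>])
    fix \<rho> assume \<rho>: "?Q \<rho>"
    have "\<rho> = \<sigma> \<or> perm_greater \<sigma> \<rho>" "\<sigma> = \<rho> \<or> perm_greater \<rho> \<sigma>"
      using \<sigma> \<rho> by blast+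
    then show "\<rho> = \<sigma>"
      using perm_greater_asym by blast
  qed (rule \<sigma>)
  then have "?Q (THE \<sigma>. ?Q \<sigma>)"
    by (rule theI')
  then show ?thesis
    using assms(1) by (simp add: principal_submatrix_def sigma_of_def)
qed

section \<open>Uniqueness and existence of the QR decomposition\<close>

lemma is_QR_inner:
  assumes "is_QR A Q R"
  shows "column i Q \<bullet> column j Q = (if i = j then 1 else 0)"
proof -
  have "column i Q \<bullet> column j Q = (transpose Q ** Q) $ i $ j"
    by (simp add: matrix_matrix_mult_def transpose_def column_def inner_vec_def)
  then show ?thesis
    using assms by (simp add: is_QR_def mat_def)
qed

lemma is_QR_column:
  assumes "is_QR A Q R"
  shows "column j A = (\<Sum>i\<in>UNIV. R $ i $ j *\<^sub>R column i Q)"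
proof -
  have "A = Q ** R"
    using assms by (simp add: is_QR_def)
  then show ?thesis
    by (simp add: vec_eq_iff column_def matrix_matrix_mult_def mult.commute)
qed

lemma is_QR_entry:
  assumes "is_QR A Q R"
  shows "R $ i $ j = column i Q \<bullet> column j A"
  by (simp add: is_QR_column[OF assms, of j] inner_sum_right is_QR_inner[OF assms] mult_delta_right)

text \<open>Induction over columns: if the earlier columns of \<open>Q\<close> and \<open>Q'\<close>
  agree, \<open>is_QR_entry\<close> makes the coefficients above the diagonal agree, which leaves
  the diagonal terms equal. Unit norms and positive diagonals separate scalar from column.\<close>

lemma is_QR_unique:
  assumes "is_QR A Q R" "is_QR A Q' R'"
  shows "Q = Q' \<and> R = R'"
proof -
  have split: "column j A = (\<Sum>i | i < j. R $ i $ j *\<^sub>R column i Q) + R $ j $ j *\<^sub>R column j Q"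
    if "is_QR A Q R" for Q R j
  proof -
    have "column j A = (\<Sum>i\<in>insert j {i. i < j}. R $ i $ j *\<^sub>R column i Q)"
      unfolding is_QR_column[OF that]
      using that by (intro sum.mono_neutral_right) (auto simp: is_QR_def)
    then show ?thesis by simp
  qed
  have norm1: "norm (column j Q) = 1" if "is_QR A Q R" for Q R j
    using is_QR_inner[OF that, of j j] by (simp add: norm_eq_sqrt_inner)
  have col: "column j Q = column j Q'" for j
  proof (induction j rule: less_induct)
    case (less j)
    have "(\<Sum>i | i < j. R $ i $ j *\<^sub>R column i Q) = (\<Sum>i | i < j. R' $ i $ j *\<^sub>R column i Q')"
      using less by (intro sum.cong) (auto simp: is_QR_entry[OF assms(1)] is_QR_entry[OF assms(2)])
    then have eq: "R $ j $ j *\<^sub>R column j Q = R' $ j $ j *\<^sub>R column j Q'"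
      using split[OF assms(1), of j] split[OF assms(2), of j] by simp
    have pos: "0 < R $ j $ j" "0 < R' $ j $ j"
      using assms by (auto simp: is_QR_def)
    have "R $ j $ j = R' $ j $ j"
      using arg_cong[OF eq, of norm] pos by (simp add: norm1[OF assms(1)] norm1[OF assms(2)])
    then show ?case
      using eq pos by simp
  qed
  then have "Q = Q'"
    by (simp add: vec_eq_iff column_def)
  moreover have "R = R'"
    by (simp add: vec_eq_iff is_QR_entry[OF assms(1)] is_QR_entry[OF assms(2)] col)
  ultimately show ?thesis
    by simp
qed

text \<open>Orthonormality makes \<open>q\<close> injective, so the expansion over the set
  \<open>range q\<close> becomes a sum over indices.\<close>

lemma orthonormal_family_expand:
  fixes q :: "'n::finite \<Rightarrow> 'a::real_inner"
  assumes "\<And>i j. q i \<bullet> q j = (if i = j then 1 else 0)" "x \<in> span (range q)"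
  shows "(\<Sum>i\<in>UNIV. (q i \<bullet> x) *\<^sub>R q i) = x"
proof -
  have "inj q"
    using assms(1) by (metis injI zero_neq_one)
  have "(\<Sum>b\<in>range q. (x \<bullet> b) *\<^sub>R b) = x"
    using assms by (intro orthonormal_basis_expand)
      (auto simp: pairwise_def orthogonal_def norm_eq_sqrt_inner)
  then show ?thesis
    by (simp add: sum.reindex[OF \<open>inj q\<close>] inner_commute)
qed

text \<open>
  Gram--Schmidt without recursion: \<open>q j\<close> is the normalised component of the \<open>j\<close>-th column that is
  orthogonal to the span of the preceding columns.
\<close>

lemma is_QR_exists:
  fixes A :: "real^'n::{finite,wellorder}^'m::finite"
  assumes "inj (\<lambda>j. column j A)" "independent (range (\<lambda>j. column j A))"
  shows "\<exists>Q R. is_QR A Q R"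
proof -
  define a where "a = (\<lambda>j. column j A)"
  have a: "inj a" "independent (range a)"
    using assms by (simp_all add: a_def)
  have "\<exists>y z. y \<in> span (a ` {..<j}) \<and> (\<forall>w \<in> span (a ` {..<j}). orthogonal z w) \<and> a j = y + z" for j
    using orthogonal_subspace_decomp_exists[of "a ` {..<j}" "a j"] by metis
  then obtain y z where y: "\<And>j. y j \<in> span (a ` {..<j})"
    and z: "\<And>j w. w \<in> span (a ` {..<j}) \<Longrightarrow> z j \<bullet> w = 0"
    and yz: "\<And>j. a j = y j + z j"
    unfolding orthogonal_def by metis
  define q where "q = (\<lambda>j. z j /\<^sub>R norm (z j))"
  have nz: "norm (z j) > 0" for j
  proof -
    \<comment> \<open>Injectivity keeps \<open>a j\<close> out of the preceding columns, so
      independence applies and \<open>z j\<close> cannot vanish.\<close>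
    have "a ` {..<j} \<subseteq> range a - {a j}"
      using a(1) by (auto dest: injD)
    then have "a j \<notin> span (a ` {..<j})"
      using a(2) span_mono unfolding dependent_def by blast
    then show ?thesis
      using y[of j] yz[of j] by auto
  qed
  have zq: "z j = norm (z j) *\<^sub>R q j" for j
    using nz[of j] by (simp add: q_def)
  have q_perp: "q j \<bullet> w = 0" if "w \<in> span (a ` {..<j})" for j w
    using z[OF that] by (simp add: q_def)
  \<comment> \<open>With \<open>q_perp\<close> this yields orthogonality: of two members, the later
    is perpendicular to a span containing the earlier.\<close>
  have q_in: "q k \<in> span (a ` {..<j})" if "k < j" for j k
  proof -
    have "y k \<in> span (a ` {..<j})"
      using y[of k] span_mono[of "a ` {..<k}" "a ` {..<j}"] that
      by (meson image_mono lessThan_subset_iff less_imp_le subsetD)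
    moreover have "a k \<in> span (a ` {..<j})"
      using that by (auto intro: span_base)
    ultimately have "z k \<in> span (a ` {..<j})"
      using span_diff[of "a k" _ "y k"] yz[of k] by simp
    then show ?thesis
      by (simp add: q_def span_scale)
  qed
  have orth: "q i \<bullet> q j = (if i = j then 1 else 0)" for i j
  proof (cases i j rule: linorder_cases)
    case equal
    then show ?thesis
      using nz[of j] by (simp add: q_def power2_norm_eq_inner[symmetric] power2_eq_square field_simps)
  next
    case less
    then show ?thesis
      using q_perp[OF q_in[OF less]] by (simp add: inner_commute)
  next
    case greater
    then show ?thesis
      using q_perp[OF q_in[OF greater]] by simp
  qed
  have a_in: "a j \<in> span (range q)" for j
  proof (induction j rule: less_induct)
    case (less j)
    then have "span (a ` {..<j}) \<subseteq> span (range q)"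
      by (intro span_minimal) auto
    moreover have "z j \<in> span (range q)"
      by (subst zq) (auto intro: span_scale span_base)
    ultimately show ?case
      using y yz[of j] by (auto intro: span_add)
  qed
  define Q :: "real^'n::_^'m::_" where "Q = (\<chi> i j. q j $ i)"
  \<comment> \<open>By \<open>is_QR_entry\<close> no other choice of entries is possible.\<close>
  define R :: "real^'n::_^'n::_" where "R = (\<chi> i j. q i \<bullet> a j)"
  have "is_QR A Q R"
    unfolding is_QR_def
  proof (intro conjI allI impI)
    show "A = Q ** R"
    proof -
      have "A $ i $ j = (Q ** R) $ i $ j" for i j
      proof -
        have "A $ i $ j = a j $ i"
          by (simp add: a_def column_def)
        also have "\<dots> = (\<Sum>k\<in>UNIV. (q k \<bullet> a j) *\<^sub>R q k) $ i"
          by (simp only: orthonormal_family_expand[OF orth a_in])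
        finally show ?thesis
          by (simp add: Q_def R_def matrix_matrix_mult_def mult.commute)
      qed
      then show ?thesis by (simp add: vec_eq_iff)
    qed
    show "transpose Q ** Q = mat 1"
      using orth by (simp add: vec_eq_iff Q_def matrix_matrix_mult_def transpose_def mat_def inner_vec_def)
    show "R $ i $ j = 0" if "j < i" for i j
      using that by (simp add: R_def q_perp span_base)
    show "0 < R $ i $ i" for i
    proof -
      \<comment> \<open>The component \<open>y i\<close> is perpendicular to \<open>q i\<close>, so
        the diagonal entry is the norm of \<open>z i\<close>.\<close>
      have "q i \<bullet> a i = q i \<bullet> (norm (z i) *\<^sub>R q i)"
        using q_perp[OF y[of i]] by (simp add: yz inner_add_right flip: zq)
      then show ?thesis
        using nz[of i] by (simp add: R_def orth)
    qed
  qed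
  then show ?thesis by blast
qed

lemma QR_Q_eq: "is_QR A Q R \<Longrightarrow> QR_Q A = Q"
  unfolding QR_Q_def by (subst the_equality[of _ "(Q, R)"]) (auto dest: is_QR_unique)

section \<open>The generalized volume of the parallel polyhedron\<close>

text \<open>The transpose of \<open>Q\<close> is a map of the required kind, so the choice in
  \<open>frame_map\<close> has a witness.\<close>

lemma frame_map_props:
  fixes A Q :: "real^'n::{finite,wellorder}^'m::finite"
  assumes "is_QR A Q R"
  shows "linear (frame_map Q)" "frame_map Q (column i Q) = axis i 1"
proof -
  have "transpose Q *v column i Q = axis i 1" for i
    using is_QR_inner[OF assms]
    by (simp add: vec_eq_iff matrix_vector_mult_def transpose_def axis_def column_def inner_vec_def)
  then have "\<exists>\<phi> :: real^'m::_ \<Rightarrow> real^'n::_. linear \<phi> \<and> (\<forall>i. \<phi> (column i Q) = axis i 1)"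
    by (intro exI[of _ "(*v) (transpose Q)"]) simp
  from someI_ex[OF this]
  show "linear (frame_map Q)" "frame_map Q (column i Q) = axis i 1"
    unfolding frame_map_def by auto
qed

lemma GV_parallel_polyhedron:
  fixes \<alpha> :: "'n::{finite,wellorder} \<Rightarrow> real^'m::finite"
  assumes "is_QR (cols_matrix \<alpha>) Q R"
  shows "GV (cols_matrix \<alpha>) (parallel_polyhedron \<alpha>) = \<bar>det R\<bar>"
proof -
  let ?\<phi> = "frame_map Q"
  note \<phi> = frame_map_props[OF assms]
  \<comment> \<open>Column \<open>j\<close> of \<open>R\<close> holds the coordinates of
    \<open>\<alpha> j\<close> in the frame given by \<open>Q\<close>.\<close>
  have "?\<phi> (\<alpha> j) = column j R" for j
  proof -
    have "\<alpha> j = column j (cols_matrix \<alpha>)"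
      by (simp add: cols_matrix_def column_def vec_eq_iff)
    then have "?\<phi> (\<alpha> j) = (\<Sum>i\<in>UNIV. R $ i $ j *\<^sub>R axis i 1)"
      by (simp add: is_QR_column[OF assms] linear_sum[OF \<phi>(1)] linear_scale[OF \<phi>(1)] \<phi>(2))
    also have "\<dots> = column j R"
      by (simp add: vec_eq_iff column_def axis_def if_distrib cong: if_cong)
    finally show ?thesis .
  qed
  then have image: "?\<phi> (\<Sum>i\<in>UNIV. x i *\<^sub>R \<alpha> i) = R *v (\<chi> i. x i)" for x
    by (simp add: linear_sum[OF \<phi>(1)] linear_scale[OF \<phi>(1)] matrix_mult_sum scalar_mult_eq_scaleR)
  \<comment> \<open>\<open>One\<close> is the sum of all basis vectors, so \<open>cbox 0 One\<close>
    is the unit cube, of measure 1.\<close>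
  have One: "(One :: real^'n::_) $ i = 1" for i
    by (simp only: cart_eq_inner_axis inner_sum_left_Basis axis_in_Basis_iff) simp
  have unit_box: "x \<in> cbox 0 One \<longleftrightarrow> (\<forall>i. 0 \<le> x $ i \<and> x $ i \<le> 1)" for x :: "real^'n::_"
    by (simp only: mem_box_cart zero_index One)
  have "?\<phi> ` parallel_polyhedron \<alpha> = (*v) R ` cbox 0 One"
  proof (intro subset_antisym image_subsetI)
    fix v assume "v \<in> parallel_polyhedron \<alpha>"
    then obtain x where "v = (\<Sum>i\<in>UNIV. x i *\<^sub>R \<alpha> i)" "\<forall>i. 0 \<le> x i \<and> x i \<le> 1"
      by (auto simp: parallel_polyhedron_def)
    then show "?\<phi> v \<in> (*v) R ` cbox 0 One"
      by (auto simp: image unit_box intro!: imageI)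
  next
    fix x :: "real^'n::_" assume "x \<in> cbox 0 One"
    then have "(\<Sum>i\<in>UNIV. x $ i *\<^sub>R \<alpha> i) \<in> parallel_polyhedron \<alpha>"
      by (auto simp: parallel_polyhedron_def unit_box intro!: exI[of _ "\<lambda>i. x $ i"])
    then show "R *v x \<in> ?\<phi> ` parallel_polyhedron \<alpha>"
      using image[of "\<lambda>i. x $ i"] by (auto intro!: image_eqI)
  qed
  then have "GV (cols_matrix \<alpha>) (parallel_polyhedron \<alpha>) = measure lebesgue ((*v) R ` cbox 0 One)"
    by (simp add: GV_def QR_Q_eq[OF assms])
  also have "\<dots> = \<bar>det R\<bar>"
    by (simp add: measure_linear_image)
  finally show ?thesis .
qed

theorem theorem4p4:
  fixes \<alpha> :: "'n::{finite,wellorder} \<Rightarrow> real^'m::{finite,wellorder}"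
  assumes "CARD('n) \<le> CARD('m)"
    and "inj \<alpha>" and "independent (range \<alpha>)"
  shows "GV (cols_matrix \<alpha>) (parallel_polyhedron \<alpha>) = \<bar>Gdet (cols_matrix \<alpha>)\<bar>"
proof -
  let ?A = "cols_matrix \<alpha>"
  let ?D = "\<lambda>r. det (\<chi> k. ?A $ r k :: real^'n::_^'n::_)"
  have col: "(\<lambda>j. column j ?A) = \<alpha>"
    by (simp add: fun_eq_iff cols_matrix_def column_def vec_eq_iff)
  obtain Q R where QR: "is_QR ?A Q R"
    using is_QR_exists[of ?A, unfolded col, OF assms(2,3)] by blast
  then have "?A = Q ** R"
    by (simp add: is_QR_def)
  then have "transpose ?A ** ?A = transpose R ** (transpose Q ** Q) ** R"
    by (simp add: matrix_transpose_mul matrix_mul_assoc)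
  also have "\<dots> = transpose R ** R"
    using QR by (simp add: is_QR_def)
  finally have sum: "(\<Sum>r | strict_mono (r :: 'n \<Rightarrow> 'm). (?D r)\<^sup>2) = (det R)\<^sup>2"
    using Cauchy_Binet[of ?A ?A] by (simp add: det_mul det_transpose power2_eq_square)
  have "det R = (\<Prod>i\<in>UNIV. R $ i $ i)"
    using QR by (intro det_upperdiagonal) (simp add: is_QR_def)
  then have "det R \<noteq> 0"
    using QR by (simp add: is_QR_def less_imp_neq[symmetric])
  with sum obtain r :: "'n \<Rightarrow> 'm" where r: "strict_mono r" "?D r \<noteq> 0"
    by (metis (mono_tags, lifting) mem_Collect_eq power_zero_numeral sum.neutral zero_eq_power2)
  then have "\<exists>\<sigma>. \<sigma> permutes UNIV \<and> det (perm_submatrix ?A \<sigma>) \<noteq> 0"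
    using ex_perm_submatrix_eq[OF assms(1) strict_mono_imp_inj_on[OF r(1)], of ?A] by metis
  \<comment> \<open>Full rank excludes the default value \<open>id\<close> of
    \<open>sigma_of\<close>; injectivity of \<open>\<alpha>\<close> is what makes the independent
    set of columns have \<open>CARD('n)\<close> elements.\<close>
  moreover have "rank ?A = CARD('n)"
  proof -
    have "columns ?A = range \<alpha>"
      using col by (auto simp: columns_def fun_eq_iff)
    then show ?thesis
      using assms by (simp add: column_rank_def dim_eq_card_independent card_image)
  qed
  ultimately have "\<bar>mat_sign ?A\<bar> = 1"
    using det_principal_submatrix_nonzero by (simp add: mat_sign_def abs_sgn_eq)
  then have "\<bar>Gdet ?A\<bar> = \<bar>det R\<bar>"
    by (simp add: Gdet_def abs_mult sum)
  then show ?thesis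
    by (simp add: GV_parallel_polyhedron[OF QR])
qed

end
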